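(* Consider the Two-Stage Stochastic Matching Bottleneck problem (TSSMB) with scenarios $S_1,\dots,S_q$, all of the same size $k$, and no surplus, i.e. $|D|=|R_1|+k$. Let $OPT_1$ and $OPT_2$ be the first-stage cost and the expected second-stage cost of an optimal solution. For each $i\in\{1,\dots,q\}$ let $D^1_i$ be an optimal solution of the single-scenario problem $$\min_{D_1\subseteq D,\ |D_1|=|R_1|}\{cost_1(D_1,R_1)+cost_2(D\setminus D_1,S_i)\},$$ and let $D_1$ be a set among $D^1_1,\dots,D^1_q$ minimizing $f(D^1_i)$. Then $f(D_1)\le OPT_1+3\,OPT_2$.
   Context: TSSMB: an instance consists of finite sets $D$ (drivers), $R_1$ (first-stage riders, $m=|R_1|$), $R_2$ (second-stage riders), an explicit list of scenarios $S_1,\dots,S_q\subseteq R_2$ with probabilities $p_1,\dots,p_q\ge0$, $\sum_i p_i=1$, and a metric $d$ on $R_1\cup R_2\cup D$. A feasible solution is a set $D_1\subseteq D$ with $|D_1|=|R_1|$. Define $cost_1(D_1,R_1)=\frac1m\sum_{(i,j)\in M_1}d(i,j)$, where $M_1$ is a minimum-weight perfect matching between $R_1$ and $D_1$. For a set of drivers $A$ and a scenario $S$, $cost_2(A,S)$ is the bottleneck matching cost: the minimum, over all matchings of $A$ and $S$ covering every element of $S$, of the largest distance of a matched pair. The objective is to minimize $f(D_1)=cost_1(D_1,R_1)+\sum_{i=1}^q p_i\,cost_2(D\setminus D_1,S_i)$. For an optimal solution $D_1^*$, $OPT_1=cost_1(D_1^*,R_1)$ and $OPT_2=\sum_{i=1}^q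 p_i\,cost_2(D\setminus D_1^*,S_i)$. *)

theory Defs
  imports "HOL-Analysis.Abstract_Metric_Spaces"
begin

text \<open>Drivers and riders are points of one metric space. The two sides of a matching are kept
  apart by the order of the pairs, so \<open>D\<close>, \<open>R1\<close> and \<open>R2\<close> are not required to be disjoint.\<close>

locale tssmb = Metric_space "R1 \<union> R2 \<union> D" d
  for D R1 R2 :: "'a set" and d :: "'a \<Rightarrow> 'a \<Rightarrow> real" +
  fixes q :: nat and S :: "nat \<Rightarrow> 'a set" and p :: "nat \<Rightarrow> real"
  assumes finite_D: "finite D"
    and finite_R1: "finite R1"
    and finite_R2: "finite R2"
    and scenario_subset: "\<And>i. i \<in> {1..q} \<Longrightarrow> S i \<subseteq> R2"
    and prob_nonneg: "\<And>i. i \<in> {1..q} \<Longrightarrow> 0 \<le> p i"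
    and prob_sum: "(\<Sum>i\<in>{1..q}. p i) = 1"

definition matching :: "'a set \<Rightarrow> 'b set \<Rightarrow> ('a \<times> 'b) set \<Rightarrow> bool" where
  "matching A B M \<longleftrightarrow> M \<subseteq> A \<times> B \<and> inj_on fst M \<and> inj_on snd M"

definition perfect_matching :: "'a set \<Rightarrow> 'b set \<Rightarrow> ('a \<times> 'b) set \<Rightarrow> bool" where
  "perfect_matching A B M \<longleftrightarrow> matching A B M \<and> fst ` M = A \<and> snd ` M = B"

definition matching_weight :: "('a \<Rightarrow> 'a \<Rightarrow> real) \<Rightarrow> ('a \<times> 'a) set \<Rightarrow> real" where
  "matching_weight d M = (\<Sum>(i, j)\<in>M. d i j)"

text \<open>The empty matching, which arises only for an empty scenario, has bottleneck \<open>0\<close>.\<close>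

definition bottleneck :: "('a \<Rightarrow> 'a \<Rightarrow> real) \<Rightarrow> ('a \<times> 'a) set \<Rightarrow> real" where
  "bottleneck d M = (if M = {} then 0 else Max ((\<lambda>(i, j). d i j) ` M))"

text \<open>In both costs the minimum ranges over a finite set of matchings. That set is nonempty when
  \<open>card A = card R1\<close>, respectively \<open>card S \<le> card A\<close>; otherwise the value is unspecified.\<close>

definition cost1 :: "('a \<Rightarrow> 'a \<Rightarrow> real) \<Rightarrow> 'a set \<Rightarrow> 'a set \<Rightarrow> real" where
  "cost1 d A R1 =
     1 / real (card R1) * Min {matching_weight d M | M. perfect_matching R1 A M}"

definition cost2 :: "('a \<Rightarrow> 'a \<Rightarrow> real) \<Rightarrow> 'a set \<Rightarrow> 'a set \<Rightarrow> real" where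
  "cost2 d A S = Min {bottleneck d M | M. matching A S M \<and> snd ` M = S}"

definition feasible :: "'a set \<Rightarrow> 'a set \<Rightarrow> 'a set \<Rightarrow> bool" where
  "feasible D R1 A \<longleftrightarrow> A \<subseteq> D \<and> card A = card R1"

definition expected_cost2 ::
  "'a set \<Rightarrow> ('a \<Rightarrow> 'a \<Rightarrow> real) \<Rightarrow> nat \<Rightarrow> (nat \<Rightarrow> 'a set) \<Rightarrow> (nat \<Rightarrow> real) \<Rightarrow> 'a set \<Rightarrow> real"
  where
  "expected_cost2 D d q S p A = (\<Sum>i\<in>{1..q}. p i * cost2 d (D - A) (S i))"

definition objective ::
  "'a set \<Rightarrow> 'a set \<Rightarrow> ('a \<Rightarrow> 'a \<Rightarrow> real) \<Rightarrow> nat \<Rightarrow> (nat \<Rightarrow> 'a set) \<Rightarrow> (nat \<Rightarrow> real) \<Rightarrow> 'a set \<Rightarrow> real"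
  where
  "objective D R1 d q S p A = cost1 d A R1 + expected_cost2 D d q S p A"

end

theory Submission
  imports Defs
begin

text \<open>Without surplus, every second-stage matching is a bijection. Hence the drivers left by
  \<open>Dsc i\<close> can be matched to \<open>S j\<close> through \<open>S i\<close> and the drivers left by \<open>Dopt\<close>. With
  \<open>a\<^sub>i = cost2 d (D - Dopt) (S i)\<close> and \<open>b\<^sub>i = cost2 d (D - Dsc i) (S i)\<close>, this matching has
  bottleneck at most \<open>b\<^sub>i + a\<^sub>i + a\<^sub>j\<close>. Optimality of \<open>Dsc i\<close> for scenario \<open>i\<close> gives
  \<open>cost1 d (Dsc i) R1 + b\<^sub>i \<le> OPT1 + a\<^sub>i\<close>, so the objective at \<open>Dsc i\<close> is at most
  \<open>OPT1 + 2 * a\<^sub>i + OPT2\<close>. Averaging over \<open>i\<close> with weights \<open>p i\<close> yields the bound.\<close>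

text \<open>A matching that covers \<open>S\<close> is handled as an injection from \<open>S\<close>
  into \<open>A\<close>. Pairs list the driver first, hence \<open>(f s, s)\<close>.\<close>

lemma matching_graph:
  assumes "inj_on f S" "f ` S \<subseteq> A"
  shows "matching A S ((\<lambda>s. (f s, s)) ` S)" "snd ` (\<lambda>s. (f s, s)) ` S = S"
  using assms by (auto simp: matching_def inj_on_def image_iff)

lemma finite_bottlenecks:
  assumes "finite A" "finite S"
  shows "finite {bottleneck d M | M. matching A S M \<and> snd ` M = S}"
proof (rule finite_subset)
  show "{bottleneck d M | M. matching A S M \<and> snd ` M = S} \<subseteq> bottleneck d ` Pow (A \<times> S)"
    by (auto simp: matching_def)
qed (use assms in simp)

text \<open>The graph of \<open>f\<close> is one of the matchings over which the minimum is taken.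
  The bound \<open>0 \<le> c\<close> covers empty \<open>S\<close>, where the bottleneck is
  \<open>0\<close> by convention.\<close>

lemma cost2_le:
  assumes "finite A" "finite S" "inj_on f S" "f ` S \<subseteq> A"
    and "0 \<le> c" "\<And>s. s \<in> S \<Longrightarrow> d (f s) s \<le> c"
  shows "cost2 d A S \<le> c"
proof -
  let ?M = "(\<lambda>s. (f s, s)) ` S"
  have "cost2 d A S \<le> bottleneck d ?M"
    unfolding cost2_def using matching_graph[OF assms(3,4)]
    by (intro Min_le finite_bottlenecks assms) blast
  also have "\<dots> \<le> c"
    using assms by (auto simp: bottleneck_def)
  finally show ?thesis .
qed

text \<open>The minimum is attained: there are finitely many matchings, and the cardinality bound
  supplies at least one. An optimal matching is then read as a function on \<open>S\<close>.\<close>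

lemma cost2_witness:
  assumes "finite A" "finite S" "card S \<le> card A"
    and nonneg: "\<And>x y. 0 \<le> d x y"
  obtains f where "inj_on f S" "f ` S \<subseteq> A" "\<And>s. s \<in> S \<Longrightarrow> d (f s) s \<le> cost2 d A S"
    "0 \<le> cost2 d A S"
proof -
  obtain g where g: "g ` S \<subseteq> A" "inj_on g S"
    using card_le_inj[OF assms(2,1,3)] by blast
  then have "{bottleneck d M | M. matching A S M \<and> snd ` M = S} \<noteq> {}"
    using matching_graph[OF g(2,1)] by blast
  then have "cost2 d A S \<in> {bottleneck d M | M. matching A S M \<and> snd ` M = S}"
    unfolding cost2_def by (intro Min_in finite_bottlenecks assms)
  then obtain M where M: "matching A S M" "snd ` M = S" "cost2 d A S = bottleneck d M"
    by blast
  then have sub: "M \<subseteq> A \<times> S" and fst: "inj_on fst M"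
    by (auto simp: matching_def)
  have "finite M"
    using sub assms(1,2) finite_subset by blast
  then have d_le: "d x y \<le> cost2 d A S" if "(x, y) \<in> M" for x y
    using that by (auto simp: M(3) bottleneck_def intro!: Max_ge)
  have "\<forall>s\<in>S. \<exists>x. (x, s) \<in> M"
    using M(2) by force
  then obtain f where f: "\<And>s. s \<in> S \<Longrightarrow> (f s, s) \<in> M"
    by metis
  \<comment> \<open>If \<open>f s = f s'\<close>, the pairs \<open>(f s, s)\<close> and
    \<open>(f s', s')\<close> share their first component, so they coincide.\<close>
  have "inj_on f S"
    using inj_onD[OF fst _ f f] by (auto intro: inj_onI)
  moreover have "f ` S \<subseteq> A"
    using f sub by blast
  moreover have "0 \<le> cost2 d A S"
  proof (cases "M = {}")
    case True
    then show ?thesis by (simp add: M(3) bottleneck_def)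
  next
    case False
    then obtain x y where "(x, y) \<in> M" by auto
    then show ?thesis using d_le nonneg order_trans by blast
  qed
  ultimately show ?thesis
    using that f d_le by blast
qed

text \<open>Compose three optimal matchings, from \<open>T\<close> to \<open>B\<close>, back from
  \<open>B\<close> to \<open>S\<close>, then from \<open>S\<close> to \<open>A\<close>, and apply
  the triangle inequality twice.\<close>

lemma (in Metric_space) cost2_detour:
  assumes sub: "A \<subseteq> M" "B \<subseteq> M" "S \<subseteq> M" "T \<subseteq> M"
    and fin: "finite A" "finite B" "finite S" "finite T"
    and card: "card S = card A" "card S = card B" "card T = card B"
  shows "cost2 d A T \<le> cost2 d A S + cost2 d B S + cost2 d B T"
proof -
  obtain f where f: "inj_on f S" "f ` S \<subseteq> A" "\<And>s. s \<in> S \<Longrightarrow> d (f s) s \<le> cost2 d A S"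
    "0 \<le> cost2 d A S"
    using cost2_witness[of A S d] fin card nonneg by auto
  obtain g where g: "inj_on g S" "g ` S \<subseteq> B" "\<And>s. s \<in> S \<Longrightarrow> d (g s) s \<le> cost2 d B S"
    "0 \<le> cost2 d B S"
    using cost2_witness[of B S d] fin card nonneg by auto
  obtain h where h: "inj_on h T" "h ` T \<subseteq> B" "\<And>s. s \<in> T \<Longrightarrow> d (h s) s \<le> cost2 d B T"
    "0 \<le> cost2 d B T"
    using cost2_witness[of B T d] fin card nonneg by auto
  \<comment> \<open>Equal cardinalities make \<open>g\<close> onto, so it can be inverted at every
    \<open>h t\<close>.\<close>
  have gS: "g ` S = B"
    using g fin card by (intro card_subset_eq) (auto simp: card_image)
  let ?r = "\<lambda>t. inv_into S g (h t)"
  have r: "?r t \<in> S" "g (?r t) = h t" if "t \<in> T" for t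
    using h(2) gS image_subset_iff inv_into_into[of "h t" g S] f_inv_into_f[of "h t" g S] that
    by blast+
  show ?thesis
  proof (rule cost2_le)
    show "inj_on (f \<circ> ?r) T"
      using f(1) h(1) r unfolding inj_on_def o_def by metis
    show "(f \<circ> ?r) ` T \<subseteq> A"
      using f(2) r by auto
    show "d ((f \<circ> ?r) t) t \<le> cost2 d A S + cost2 d B S + cost2 d B T" if t: "t \<in> T" for t
    proof -
      have mem: "f (?r t) \<in> M" "?r t \<in> M" "h t \<in> M" "t \<in> M"
        using t r[OF t] f(2) h(2) sub by auto
      have "d (f (?r t)) t \<le> d (f (?r t)) (?r t) + d (?r t) (h t) + d (h t) t"
        using triangle[of "f (?r t)" "?r t" t] triangle[of "?r t" "h t" t] mem by linarith
      then show ?thesis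
        using f(3)[of "?r t"] g(3)[of "?r t"] h(3)[of t] r[OF t] t commute[of "?r t" "h t"]
        by simp
    qed
  qed (use fin f g h in auto)
qed

theorem theorem9:
  fixes D R1 R2 :: "'a set" and d :: "'a \<Rightarrow> 'a \<Rightarrow> real"
    and q k :: nat and S :: "nat \<Rightarrow> 'a set" and p :: "nat \<Rightarrow> real"
    and Dopt D1 :: "'a set" and Dsc :: "nat \<Rightarrow> 'a set" and OPT1 OPT2 :: real
  assumes "tssmb D R1 R2 d q S p"
    and "\<And>i. i \<in> {1..q} \<Longrightarrow> card (S i) = k"
    and "card D = card R1 + k"
    and "is_arg_min (objective D R1 d q S p) (feasible D R1) Dopt"
    and "OPT1 = cost1 d Dopt R1"
    and "OPT2 = expected_cost2 D d q S p Dopt"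
    and "\<And>i. i \<in> {1..q} \<Longrightarrow>
           is_arg_min (\<lambda>A. cost1 d A R1 + cost2 d (D - A) (S i)) (feasible D R1) (Dsc i)"
    and "is_arg_min (objective D R1 d q S p) (\<lambda>A. A \<in> Dsc ` {1..q}) D1"
  shows "objective D R1 d q S p D1 \<le> OPT1 + 3 * OPT2"
proof -
  interpret tssmb D R1 R2 d q S p by fact
  let ?f = "objective D R1 d q S p"
  define a where "a i = cost2 d (D - Dopt) (S i)" for i
  have OPT2: "OPT2 = (\<Sum>i\<in>{1..q}. p i * a i)"
    using assms(6) by (simp add: expected_cost2_def a_def)
  have card_diff: "card (D - A) = k" if "feasible D R1 A" for A
    using that assms(3) finite_D by (auto simp: feasible_def card_Diff_subset finite_subset)
  have opt: "feasible D R1 Dopt"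
    using assms(4) by (simp add: is_arg_min_def)
  have scen: "?f (Dsc i) \<le> OPT1 + 2 * a i + OPT2" if i: "i \<in> {1..q}" for i
  proof -
    let ?b = "cost2 d (D - Dsc i) (S i)"
    have feas: "feasible D R1 (Dsc i)"
      and le: "cost1 d (Dsc i) R1 + ?b \<le> OPT1 + a i"
      using assms(7)[OF i] opt by (auto simp: is_arg_min_linorder assms(5) a_def)
    have "cost2 d (D - Dsc i) (S j) \<le> ?b + a i + a j" if j: "j \<in> {1..q}" for j
      unfolding a_def
    proof (rule cost2_detour)
      show "finite (S i)" "finite (S j)"
        using scenario_subset i j finite_R2 finite_subset by blast+
    qed (use scenario_subset[OF i] scenario_subset[OF j] assms(2) i j card_diff opt feas finite_D
        in auto)
    then have "expected_cost2 D d q S p (Dsc i) \<le> (\<Sum>j\<in>{1..q}. p j * (?b + a i + a j))"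
      unfolding expected_cost2_def by (intro sum_mono mult_left_mono prob_nonneg) auto
    also have "\<dots> = (\<Sum>j\<in>{1..q}. p j) * (?b + a i) + OPT2"
      by (simp add: OPT2 distrib_left sum.distrib sum_distrib_right)
    also have "\<dots> = ?b + a i + OPT2"
      by (simp only: prob_sum mult_1)
    \<comment> \<open>One \<open>a i\<close> comes from the detour; the other arises when
      \<open>le\<close> replaces \<open>cost1 d (Dsc i) R1 + ?b\<close>.\<close>
    finally show ?thesis
      using le by (simp add: objective_def)
  qed
  \<comment> \<open>The best candidate costs no more than the \<open>p\<close>-weighted average of
    all candidates.\<close>
  have "?f D1 = (\<Sum>i\<in>{1..q}. p i * ?f D1)"
    by (metis prob_sum sum_distrib_right mult_1)
  also have "\<dots> \<le> (\<Sum>i\<in>{1..q}. p i * (OPT1 + 2 * a i + OPT2))"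
  proof (intro sum_mono mult_left_mono prob_nonneg)
    fix i assume i: "i \<in> {1..q}"
    then have "?f D1 \<le> ?f (Dsc i)"
      using assms(8) by (auto simp: is_arg_min_linorder)
    with scen[OF i] show "?f D1 \<le> OPT1 + 2 * a i + OPT2"
      by linarith
  qed auto
  \<comment> \<open>The weighted average of the \<open>a i\<close> is \<open>OPT2\<close>
    itself.\<close>
  also have "\<dots> = (\<Sum>i\<in>{1..q}. p i) * (OPT1 + OPT2) + 2 * OPT2"
    unfolding OPT2 sum_distrib_left[of 2] sum_distrib_right[of p] sum.distrib[symmetric]
    by (simp add: algebra_simps)
  also have "\<dots> = OPT1 + 3 * OPT2"
    by (simp only: prob_sum mult_1)
  finally show ?thesis .
qed

end
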